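(* Let $0<\alpha<1$, $0\le\beta\le 1$, $\gamma=\alpha+\beta(1-\alpha)$, $a,x_0\in\mathbb{R}$, $h>0$, $b>0$. Let $E=\{y\in\mathbb{R}:|y-x_0|\le b\}$ and let $f$ be a real-valued function defined on $G=\{(t,x): t\in(a,a+h],\ (t-a)^{1-\gamma}x\in E\}$, so that $(t,y)\mapsto f(t,(t-a)^{\gamma-1}y)$ is defined on $(a,a+h]\times E$. Let $k>\beta(1-\alpha)-1$ and $M\ge 0$ be real numbers, and put $$l=\min\left\{h,\left(\frac{b}{M}\,\frac{\Gamma(\alpha)}{\mathbb{B}(\alpha,k+1)}\right)^{\frac{1}{\mu+k}}\right\},\qquad \mu=1-\beta(1-\alpha)$$ (with $l=h$ if $M=0$). Assume: (i) for every $t\in(a,a+h]$ the map $y\mapsto f(t,(t-a)^{\gamma-1}y)$ is continuous on $E$, and for every $y\in E$ the map $t\mapsto f(t,(t-a)^{\gamma-1}y)$ is measurable on $(a,a+h]$; (ii) $|f(t,(t-a)^{\gamma-1}y)|\le M(t-a)^k$ for all $t\in(a,a+h]$ and $y\in E$; (iii) there is $A>0$ such that $|f(t,(t-a)^{\gamma-1}y_1)-f(t,(t-a)^{\gamma-1}y_2)|\le A(t-a)^k|y_1-y_2|$ for all $t\in(a,a+l]$ and $y_1,y_2\in E$. Define $\phi_0(t)=x_0(t-a)^{\gamma-1}$ and, for $n=1,2,\dots$, $$\phi_n(t)=\phi_0(t)+\int_a^t\frac{(t-s)^{\alpha-1}}{\Gamma(\alpha)}f(s,\phi_{n-1}(s))\,ds,\qquad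 t\in(a,a+l].$$ Then the sequence of functions $t\mapsto(t-a)^{1-\gamma}\phi_n(t)$ is uniformly convergent on $[a,a+l]$, where the value of each of these functions at $t=a$ is taken to be its limit $x_0$ as $t\to a^+$.
   Context: $\Gamma$ is Euler's gamma function and $\mathbb{B}(x,y)=\int_0^1(1-s)^{x-1}s^{y-1}ds=\Gamma(x)\Gamma(y)/\Gamma(x+y)$ for $x,y>0$. *)

theory Defs
  imports "HOL-Analysis.Analysis"
begin

definition range_E :: "real \<Rightarrow> real \<Rightarrow> real set" where
  "range_E x0 b = {y. \<bar>y - x0\<bar> \<le> b}"

definition dom_G :: "real \<Rightarrow> real \<Rightarrow> real \<Rightarrow> real \<Rightarrow> real \<Rightarrow> (real \<times> real) set" where
  "dom_G \<gamma> a h x0 b =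
     {(t, x). t \<in> {a<..a+h} \<and> (t - a) powr (1 - \<gamma>) * x \<in> range_E x0 b}"

(* The case M = 0 is the reading b / 0 = infinity of the general formula;
   without it, the convention b / 0 = 0 would give length 0. *)
definition existence_length ::
  "real \<Rightarrow> real \<Rightarrow> real \<Rightarrow> real \<Rightarrow> real \<Rightarrow> real \<Rightarrow> real" where
  "existence_length \<alpha> \<mu> k h b M =
     (if M = 0 then h
      else min h ((b / M * (Gamma \<alpha> / Beta \<alpha> (k + 1))) powr (1 / (\<mu> + k))))"

definition frac_integrand ::
  "real \<Rightarrow> (real \<Rightarrow> real \<Rightarrow> real) \<Rightarrow> (real \<Rightarrow> real) \<Rightarrow> real \<Rightarrow> real \<Rightarrow> real" where
  "frac_integrand \<alpha> f u t s = (t - s) powr (\<alpha> - 1) / Gamma \<alpha> * f s (u s)"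

(* Only the values at t > a are meaningful. *)
primrec picard_iter ::
  "real \<Rightarrow> real \<Rightarrow> real \<Rightarrow> real \<Rightarrow> (real \<Rightarrow> real \<Rightarrow> real) \<Rightarrow> nat \<Rightarrow> real \<Rightarrow> real" where
  "picard_iter \<alpha> \<gamma> a x0 f 0 = (\<lambda>t. x0 * (t - a) powr (\<gamma> - 1))"
| "picard_iter \<alpha> \<gamma> a x0 f (Suc n) =
     (\<lambda>t. x0 * (t - a) powr (\<gamma> - 1)
        + (LINT s:{a<..<t}|lebesgue. frac_integrand \<alpha> f (picard_iter \<alpha> \<gamma> a x0 f n) t s))"

end

theory Submission imports Defs begin

text \<open>
  Write \<open>u\<^sub>n(t) = (t - a)\<^bsup>1-\<gamma>\<^esup> \<phi>\<^sub>n(t)\<close> and \<open>\<delta> = \<mu> + k > 0\<close>. The Beta integral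
  \<open>\<integral>\<^sub>a\<^sup>t (t - s)\<^bsup>p-1\<^esup> (s - a)\<^bsup>q-1\<^esup> ds = B(p,q) (t - a)\<^bsup>p+q-1\<^esup>\<close> and the choice of \<open>l\<close> keep
  every \<open>u\<^sub>n\<close> within \<open>b\<close> of \<open>x0\<close>. With the Lipschitz condition it gives inductively
  \<open>\<bar>u\<^sub>n\<^sub>+\<^sub>1 - u\<^sub>n\<bar> \<le> c\<^sub>n (t - a)\<^bsup>(n+1)\<delta>\<^esup>\<close>, where
  \<open>c\<^sub>n\<^sub>+\<^sub>1 / c\<^sub>n = A B(\<alpha>, k + 1 + (n+1)\<delta>) / \<Gamma>(\<alpha>)\<close>. This ratio tends to 0 because
  \<open>B(\<alpha>, x) = O(x\<^bsup>-\<alpha>\<^esup>)\<close> by log-convexity of \<open>\<Gamma>\<close>, so the telescoping series converges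
  uniformly.
\<close>

section \<open>Weakly singular integrals and the Beta kernel\<close>

text \<open>The substitution \<open>x = (s - a) / (t - a)\<close> reduces this to the classical Beta
  integral over the unit interval.\<close>

lemma has_integral_Beta_kernel:
  fixes p q a t :: real
  assumes "0 < p" "0 < q" "a < t"
  shows "((\<lambda>s. (t - s) powr (p - 1) * (s - a) powr (q - 1)) has_integral
           Beta p q * (t - a) powr (p + q - 1)) {a..t}"
proof -
  define m where "m = 1 / (t - a)"
  have m: "m > 0" using assms by (auto simp: m_def)
  have bounds: "(0 - - (a * m)) /\<^sub>R m = a" "(1 - - (a * m)) /\<^sub>R m = t"
    using assms by (simp_all add: m_def field_simps)
  have aff: "m *\<^sub>R s + - (a * m) = (s - a) / (t - a)" for s
    by (simp add: m_def diff_divide_distrib)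
  have "((\<lambda>x. x powr (q - 1) * (1 - x) powr (p - 1)) has_integral Beta q p) (cbox 0 1)"
    using has_integral_Beta_real[of q p] assms by simp
  from has_integral_affinity'[OF this m, of "- (a * m)"]
  have "((\<lambda>s. ((s - a) / (t - a)) powr (q - 1) * (1 - (s - a) / (t - a)) powr (p - 1)) has_integral
          Beta q p * (t - a)) {a..t}"
    unfolding aff bounds using assms by (simp add: m_def mult.commute)
  \<comment> \<open>This factor restores the powers of \<open>t - a\<close> lost in normalising
    \<open>s - a\<close> and \<open>t - s\<close>; with the Jacobian \<open>t - a\<close> the total
    exponent is \<open>p + q - 1\<close>.\<close>
  from has_integral_mult_right[OF this, of "(t - a) powr (p + q - 2)"]
  have *: "((\<lambda>s. (t - a) powr (p + q - 2) *
      (((s - a) / (t - a)) powr (q - 1) * (1 - (s - a) / (t - a)) powr (p - 1))) has_integral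
          (t - a) powr (p + q - 2) * (Beta q p * (t - a))) {a..t}" .
  have "(t - a) powr (p + q - 2) * (t - a) = (t - a) powr (p + q - 1)"
    using assms powr_mult_base[of "t - a" "p + q - 2"] by (simp add: mult.commute add.commute)
  then have val: "(t - a) powr (p + q - 2) * (Beta q p * (t - a)) = Beta p q * (t - a) powr (p + q - 1)"
    by (simp add: Beta_commute mult_ac)
  have eq: "(t - a) powr (p + q - 2) *
      (((s - a) / (t - a)) powr (q - 1) * (1 - (s - a) / (t - a)) powr (p - 1))
      = (t - s) powr (p - 1) * (s - a) powr (q - 1)" if "s \<in> {a..t}" for s
  proof -
    have "1 - (s - a) / (t - a) = (t - s) / (t - a)" using assms by (simp add: field_simps)
    moreover have "(t - a) powr (p + q - 2) = (t - a) powr (q - 1) * (t - a) powr (p - 1)"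
      by (simp flip: powr_add add: algebra_simps)
    ultimately show ?thesis using assms that by (simp add: powr_divide)
  qed
  show ?thesis
    using * unfolding val by (rule has_integral_eq[rotated]) (use eq in auto)
qed

lemma set_integral_Beta_kernel:
  fixes p q a t :: real
  assumes "0 < p" "0 < q" "a < t"
  shows "set_integrable lebesgue {a<..<t} (\<lambda>s. (t - s) powr (p - 1) * (s - a) powr (q - 1))"
    and "(LINT s:{a<..<t}|lebesgue. (t - s) powr (p - 1) * (s - a) powr (q - 1))
           = Beta p q * (t - a) powr (p + q - 1)"
proof -
  \<comment> \<open>The endpoints form a null set, and the open interval is the domain of
    integration in \<open>picard_iter\<close>.\<close>
  have hi: "((\<lambda>s. (t - s) powr (p - 1) * (s - a) powr (q - 1)) has_integral
           Beta p q * (t - a) powr (p + q - 1)) {a<..<t}"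
    using has_integral_Beta_kernel[OF assms] by (simp add: has_integral_Icc_iff_Ioo)
  show si: "set_integrable lebesgue {a<..<t} (\<lambda>s. (t - s) powr (p - 1) * (s - a) powr (q - 1))"
    by (rule nonnegative_absolutely_integrable_1) (use hi in \<open>auto simp: integrable_on_def\<close>)
  show "(LINT s:{a<..<t}|lebesgue. (t - s) powr (p - 1) * (s - a) powr (q - 1))
           = Beta p q * (t - a) powr (p + q - 1)"
    using set_lebesgue_integral_eq_integral(2)[OF si] integral_unique[OF hi] by simp
qed

text \<open>The Beta kernel is an integrable majorant. The bound serves with
  \<open>q = k + 1\<close> for each \<open>F n\<close>, and with growing \<open>q\<close> for
  differences of successive \<open>F n\<close>, which is how higher powers of \<open>t - a\<close>
  accumulate.\<close>

lemma Abel_integral_bound: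
  fixes p q a t C :: real and F :: "real \<Rightarrow> real"
  assumes "0 < p" "0 < q" "a < t"
    and F: "F \<in> borel_measurable (lebesgue_on {a<..<t})"
    and bd: "\<And>s. a < s \<Longrightarrow> s < t \<Longrightarrow> \<bar>F s\<bar> \<le> C * (s - a) powr (q - 1)"
  shows "set_integrable lebesgue {a<..<t} (\<lambda>s. (t - s) powr (p - 1) / Gamma p * F s)"
    and "\<bar>LINT s:{a<..<t}|lebesgue. (t - s) powr (p - 1) / Gamma p * F s\<bar>
           \<le> C * (Beta p q / Gamma p) * (t - a) powr (p + q - 1)"
proof -
  let ?K = "\<lambda>s. (t - s) powr (p - 1) * (s - a) powr (q - 1)"
  let ?h = "\<lambda>s. C / Gamma p * ?K s"
  let ?g = "\<lambda>s. (t - s) powr (p - 1) / Gamma p * F s"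
  have G: "Gamma p > 0" using assms by simp
  have le: "norm (?g s) \<le> ?h s" if "s \<in> {a<..<t}" for s
  proof -
    have "norm (?g s) = (t - s) powr (p - 1) / Gamma p * \<bar>F s\<bar>"
      using G by (simp add: abs_mult)
    also have "\<dots> \<le> (t - s) powr (p - 1) / Gamma p * (C * (s - a) powr (q - 1))"
      using bd[of s] that G by (intro mult_left_mono) auto
    finally show ?thesis by (simp add: mult_ac)
  qed
  have hi: "set_integrable lebesgue {a<..<t} ?h"
    by (rule set_integrable_mult_right) (use set_integral_Beta_kernel[OF assms(1-3)] in simp)
  have F0: "(\<lambda>s. if s \<in> {a<..<t} then F s else 0) \<in> borel_measurable lebesgue"
    using F by (rule borel_measurable_if_I) simp
  have "(\<lambda>s. (t - s) powr (p - 1) / Gamma p) \<in> borel_measurable lborel"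
    by measurable
  then have K0: "(\<lambda>s. (t - s) powr (p - 1) / Gamma p) \<in> borel_measurable lebesgue"
    by (rule measurable_completion)
  have "(\<lambda>s. (t - s) powr (p - 1) / Gamma p * (if s \<in> {a<..<t} then F s else 0))
          \<in> borel_measurable lebesgue"
    using K0 F0 by (rule borel_measurable_times)
  also have "(\<lambda>s. (t - s) powr (p - 1) / Gamma p * (if s \<in> {a<..<t} then F s else 0))
    = (\<lambda>s. indicator {a<..<t} s *\<^sub>R ?g s)"
    by (auto simp: fun_eq_iff indicator_def)
  finally have gm: "set_borel_measurable lebesgue {a<..<t} ?g"
    unfolding set_borel_measurable_def .
  show gi: "set_integrable lebesgue {a<..<t} ?g"
  proof (rule set_integrable_bound[OF hi gm], intro AE_I2 impI)
    fix s assume "s \<in> {a<..<t}"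
    then show "norm (?g s) \<le> norm (?h s)"
      using order_trans[OF le[of s] abs_ge_self] by simp
  qed
  have "\<bar>LINT s:{a<..<t}|lebesgue. ?g s\<bar> \<le> (LINT s:{a<..<t}|lebesgue. ?h s)"
    unfolding set_lebesgue_integral_def
    by (rule integral_abs_bound_integral)
       (use gi hi le in \<open>auto simp: set_integrable_def indicator_def simp flip: real_norm_def\<close>)
  also have "\<dots> = C / Gamma p * (Beta p q * (t - a) powr (p + q - 1))"
    using set_integral_Beta_kernel(2)[OF assms(1-3)] by simp
  finally show "\<bar>LINT s:{a<..<t}|lebesgue. (t - s) powr (p - 1) / Gamma p * F s\<bar>
           \<le> C * (Beta p q / Gamma p) * (t - a) powr (p + q - 1)"
    by simp
qed

section \<open>Measurability of Volterra integrals and of Caratheodory compositions\<close>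

text \<open>
  Fubini's theorem does not apply to the completed measure directly, so \<open>F\<close> is first replaced by a
  Borel function that agrees with it almost everywhere.
\<close>
lemma borel_measurable_Volterra_integral:
  fixes K :: "real \<Rightarrow> real \<Rightarrow> real" and F :: "real \<Rightarrow> real"
  assumes K[measurable]: "case_prod K \<in> borel_measurable (borel \<Otimes>\<^sub>M borel)"
    and F: "F \<in> borel_measurable (lebesgue_on {a<..c})"
  shows "(\<lambda>t. LINT s:{a<..<t}|lebesgue. K t s * F s) \<in> borel_measurable (lebesgue_on {a<..c})"
proof -
  let ?F0 = "\<lambda>s. if s \<in> {a<..c} then F s else 0"
  have F0: "?F0 \<in> borel_measurable lebesgue"
    using F by (rule borel_measurable_if_I) simp
  then obtain F' where F'[measurable]: "F' \<in> borel_measurable lborel"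
    and ae: "AE s in lborel. ?F0 s = F' s"
    using completion_ex_borel_measurable_real by blast
  \<comment> \<open>With the limits moved into the integrand, the measure no longer depends on
    \<open>t\<close> and the integrand is jointly Borel in \<open>t\<close> and
    \<open>s\<close>.\<close>
  let ?I = "\<lambda>t. \<integral>s. (if a < s \<and> s < t then K t s * F' s else 0) \<partial>lborel"
  have "?I \<in> borel_measurable borel"
    by measurable
  then have "?I \<in> borel_measurable (lebesgue_on {a<..c})"
    by (simp add: measurable_completion measurable_restrict_space1)
  moreover have "(LINT s:{a<..<t}|lebesgue. K t s * F s) = ?I t" if "t \<in> {a<..c}" for t
  proof -
    have Kt: "(\<lambda>s. if a < s \<and> s < t then K t s else 0) \<in> borel_measurable lborel"
      by measurable
    have "(LINT s:{a<..<t}|lebesgue. K t s * F s)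
        = (\<integral>s. (if a < s \<and> s < t then K t s else 0) * ?F0 s \<partial>lebesgue)"
      unfolding set_lebesgue_integral_def using that
      by (intro Bochner_Integration.integral_cong) auto
    also have "\<dots> = (\<integral>s. (if a < s \<and> s < t then K t s else 0) * F' s \<partial>lebesgue)"
    proof (rule integral_cong_AE)
      show "(\<lambda>s. (if a < s \<and> s < t then K t s else 0) * ?F0 s) \<in> borel_measurable lebesgue"
        using measurable_completion[OF Kt] F0 by (rule borel_measurable_times)
      show "(\<lambda>s. (if a < s \<and> s < t then K t s else 0) * F' s) \<in> borel_measurable lebesgue"
        using measurable_completion[OF Kt] measurable_completion[OF F']
        by (rule borel_measurable_times)
      show "AE s in lebesgue. (if a < s \<and> s < t then K t s else 0) * ?F0 s
              = (if a < s \<and> s < t then K t s else 0) * F' s"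
        using AE_completion[OF ae] by eventually_elim simp
    qed
    also have "\<dots> = (\<integral>s. (if a < s \<and> s < t then K t s else 0) * F' s \<partial>lborel)"
      using Kt F' by (intro integral_completion borel_measurable_times)
    also have "\<dots> = ?I t"
      by (intro Bochner_Integration.integral_cong) auto
    finally show ?thesis .
  qed
  ultimately show ?thesis
    by (subst measurable_cong) (auto simp: space_restrict_space)
qed

text \<open>For \<open>u\<close> with countably many values, measurability of \<open>g x y\<close>
  in \<open>x\<close> for fixed \<open>y\<close> suffices. A general \<open>u\<close> is a pointwise
  limit of such functions, and continuity in \<open>y\<close> carries the limit through
  \<open>g x\<close>.\<close>

lemma borel_measurable_Caratheodory_compose:
  fixes g :: "'a \<Rightarrow> real \<Rightarrow> real" and u :: "'a \<Rightarrow> real"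
  assumes cont: "\<And>x. x \<in> space N \<Longrightarrow> continuous_on {c..d} (g x)"
    and meas: "\<And>y. y \<in> {c..d} \<Longrightarrow> (\<lambda>x. g x y) \<in> borel_measurable N"
    and u: "u \<in> borel_measurable N"
    and ran: "\<And>x. x \<in> space N \<Longrightarrow> u x \<in> {c..d}"
  shows "(\<lambda>x. g x (u x)) \<in> borel_measurable N"
proof (cases "c \<le> d")
  case False
  then have "space N = {}" using ran by fastforce
  then show ?thesis by (simp add: measurable_def)
next
  case True
  define clip where "clip y = max c (min d y)" for y
  have clip: "clip y \<in> {c..d}" for y using True by (auto simp: clip_def)
  \<comment> \<open>approximants with countable range, clipped because \<open>g x\<close> is only controlled on \<open>{c..d}\<close>\<close>
  define r where "r n x = clip (of_int \<lfloor>real (Suc n) * u x\<rfloor> / real (Suc n))" for n x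
  have r_meas: "(\<lambda>x. g x (r n x)) \<in> borel_measurable N" for n
    unfolding r_def
    by (rule measurable_compose_countable[where g = "\<lambda>x. \<lfloor>real (Suc n) * u x\<rfloor>"
          and f = "\<lambda>m x. g x (clip (of_int m / real (Suc n)))"])
       (use meas[OF clip] u in measurable)
  have r_lim: "(\<lambda>n. r n x) \<longlonglongrightarrow> u x" if "x \<in> space N" for x
  proof -
    have "(\<lambda>n. of_int \<lfloor>real (Suc n) * u x\<rfloor> / real (Suc n)) \<longlonglongrightarrow> u x"
    proof (rule tendsto_sandwich)
      show "\<forall>\<^sub>F n in sequentially. u x - 1 / real (Suc n) \<le> of_int \<lfloor>real (Suc n) * u x\<rfloor> / real (Suc n)"
      proof (intro always_eventually allI)
        fix n
        have "real (Suc n) * u x - 1 \<le> of_int \<lfloor>real (Suc n) * u x\<rfloor>" by linarith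
        then have "(real (Suc n) * u x - 1) / real (Suc n) \<le> of_int \<lfloor>real (Suc n) * u x\<rfloor> / real (Suc n)"
          by (rule divide_right_mono) simp
        then show "u x - 1 / real (Suc n) \<le> of_int \<lfloor>real (Suc n) * u x\<rfloor> / real (Suc n)"
          by (simp add: diff_divide_distrib del: of_nat_Suc)
      qed
      show "\<forall>\<^sub>F n in sequentially. of_int \<lfloor>real (Suc n) * u x\<rfloor> / real (Suc n) \<le> u x"
      proof (intro always_eventually allI)
        fix n
        have "of_int \<lfloor>real (Suc n) * u x\<rfloor> \<le> real (Suc n) * u x" by linarith
        then show "of_int \<lfloor>real (Suc n) * u x\<rfloor> / real (Suc n) \<le> u x"
          by (simp add: pos_divide_le_eq mult.commute del: of_nat_Suc)
      qed
      show "(\<lambda>n. u x - 1 / real (Suc n)) \<longlonglongrightarrow> u x"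
        using tendsto_diff[OF tendsto_const LIMSEQ_inverse_real_of_nat, of "u x"]
        by (simp add: inverse_eq_divide del: of_nat_Suc)
    qed simp
    then have "(\<lambda>n. r n x) \<longlonglongrightarrow> clip (u x)"
      unfolding r_def clip_def by (intro tendsto_intros)
    then show ?thesis using ran[OF that] by (simp add: clip_def)
  qed
  have "(\<lambda>n. g x (r n x)) \<longlonglongrightarrow> g x (u x)" if "x \<in> space N" for x
    by (rule continuous_on_tendsto_compose[OF cont[OF that] r_lim[OF that] ran[OF that]])
       (use clip in \<open>simp add: r_def\<close>)
  then show ?thesis
    by (rule borel_measurable_LIMSEQ_real[OF _ r_meas])
qed

section \<open>Decay of the Beta function in one argument\<close>

text \<open>Dividing by \<open>x * Gamma (x + p)\<close> bounds
  \<open>Gamma x / Gamma (x + p)\<close> by a quantity of order \<open>x powr - p\<close>.\<close>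

lemma Gamma_plus1_le_log_convex:
  fixes p x :: real
  assumes "0 < p" "p < 1" "0 < x"
  shows "x * Gamma x \<le> (x + p) powr (1 - p) * Gamma (x + p)"
proof -
  have G: "Gamma x > 0" "Gamma (x + p) > 0" "Gamma (x + p + 1) > 0" "Gamma (x + 1) > 0"
    using assms by auto
  \<comment> \<open>\<open>x + 1\<close> is the convex combination of \<open>x + p\<close> and \<open>x + p + 1\<close> with weights \<open>p\<close> and \<open>1 - p\<close>\<close>
  have "(ln \<circ> Gamma) ((1 - (1 - p)) *\<^sub>R (x + p) + (1 - p) *\<^sub>R (x + p + 1))
      \<le> (1 - (1 - p)) * (ln \<circ> Gamma) (x + p) + (1 - p) * (ln \<circ> Gamma) (x + p + 1)"
    using assms by (intro convex_onD[OF log_convex_Gamma_real]) auto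
  moreover have "(1 - (1 - p)) *\<^sub>R (x + p) + (1 - p) *\<^sub>R (x + p + 1) = x + 1"
    by (simp add: algebra_simps)
  ultimately have "ln (Gamma (x + 1)) \<le> p * ln (Gamma (x + p)) + (1 - p) * ln (Gamma (x + p + 1))"
    by simp
  also have "Gamma (x + p + 1) = (x + p) * Gamma (x + p)"
    using assms by (intro Gamma_plus1) (auto elim!: nonpos_Ints_cases)
  also have "ln ((x + p) * Gamma (x + p)) = ln (x + p) + ln (Gamma (x + p))"
    using assms G by (intro ln_mult_pos) auto
  also have "p * ln (Gamma (x + p)) + (1 - p) * (ln (x + p) + ln (Gamma (x + p)))
      = ln ((x + p) powr (1 - p)) + ln (Gamma (x + p))"
    using assms by (simp add: ln_powr algebra_simps)
  also have "\<dots> = ln ((x + p) powr (1 - p) * Gamma (x + p))"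
    using assms G by (intro ln_mult_pos[symmetric]) auto
  finally have "Gamma (x + 1) \<le> (x + p) powr (1 - p) * Gamma (x + p)"
    using assms G by simp
  moreover have "Gamma (x + 1) = x * Gamma x"
    using assms by (intro Gamma_plus1) (auto elim!: nonpos_Ints_cases)
  ultimately show ?thesis by simp
qed

text \<open>This limit lets the ratio test succeed whatever the Lipschitz constant, so no
  contraction condition on the length \<open>l\<close> arises.\<close>

lemma Beta_tendsto_0:
  fixes p :: real
  assumes "0 < p" "p < 1"
  shows "((\<lambda>x. Beta p x) \<longlongrightarrow> 0) at_top"
proof (rule tendsto_sandwich)
  show "\<forall>\<^sub>F x in at_top. 0 \<le> Beta p x"
    using eventually_gt_at_top[of 0]
    by eventually_elim (use assms in \<open>simp add: Beta_def add_pos_pos less_imp_le\<close>)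
  show "\<forall>\<^sub>F x in at_top. Beta p x \<le> Gamma p * ((x + p) powr (1 - p) / x)"
    using eventually_gt_at_top[of 0]
  proof eventually_elim
    case (elim x)
    have "Gamma x / Gamma (x + p) \<le> (x + p) powr (1 - p) / x"
      using Gamma_plus1_le_log_convex[OF assms elim] elim assms
      by (simp add: field_simps add_pos_pos)
    then have "Gamma p * (Gamma x / Gamma (x + p)) \<le> Gamma p * ((x + p) powr (1 - p) / x)"
      using assms by (intro mult_left_mono) (auto simp: less_imp_le)
    then show ?case by (simp add: Beta_def add.commute)
  qed
  \<comment> \<open>The upper bound is split into a decaying power and a factor tending to
    1.\<close>
  have "((\<lambda>x. (x + p) powr - p * ((x + p) / x)) \<longlongrightarrow> 0 * 1) at_top"
  proof (rule tendsto_mult)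
    show "((\<lambda>x. (x + p) powr - p) \<longlongrightarrow> 0) at_top"
      using assms by (intro tendsto_neg_powr filterlim_tendsto_add_at_top[OF tendsto_const filterlim_ident, of p, simplified add.commute]) auto
    have "((\<lambda>x. 1 + p / x) \<longlongrightarrow> 1 + 0) at_top"
      by (intro tendsto_intros tendsto_divide_0[OF tendsto_const] filterlim_at_top_imp_at_infinity filterlim_ident)
    moreover have "\<forall>\<^sub>F x in at_top. 1 + p / x = (x + p) / x"
      using eventually_gt_at_top[of 0] by eventually_elim (simp add: field_simps)
    ultimately show "((\<lambda>x. (x + p) / x) \<longlongrightarrow> 1) at_top"
      by (simp add: tendsto_cong)
  qed
  moreover have "\<forall>\<^sub>F x in at_top. (x + p) powr - p * ((x + p) / x) = (x + p) powr (1 - p) / x"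
    using eventually_gt_at_top[of 0]
  proof eventually_elim
    case (elim x)
    then show ?case using assms powr_mult_base[of "x + p" "- p"] by (simp add: mult.commute)
  qed
  ultimately have "((\<lambda>x. (x + p) powr (1 - p) / x) \<longlongrightarrow> 0) at_top"
    using Lim_transform_eventually by fastforce
  from tendsto_mult[OF tendsto_const this, of "Gamma p"]
  show "((\<lambda>x. Gamma p * ((x + p) powr (1 - p) / x)) \<longlongrightarrow> 0) at_top" by simp
qed simp


section \<open>Uniform convergence of the weighted Picard iterates\<close>

theorem theorem1:
  fixes \<alpha> \<beta> \<gamma> \<mu> a x0 h b k M l :: real
    and E :: "real set"
    and f :: "real \<Rightarrow> real \<Rightarrow> real"
    and \<phi> :: "nat \<Rightarrow> real \<Rightarrow> real"
  assumes "0 < \<alpha>" "\<alpha> < 1" "0 \<le> \<beta>" "\<beta> \<le> 1"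
    and "\<gamma> = \<alpha> + \<beta> * (1 - \<alpha>)" and "\<mu> = 1 - \<beta> * (1 - \<alpha>)"
    and "0 < h" "0 < b"
    and "\<beta> * (1 - \<alpha>) - 1 < k" "0 \<le> M"
    and "E = range_E x0 b"
    and "l = existence_length \<alpha> \<mu> k h b M"
    and "\<And>t. t \<in> {a<..a+h} \<Longrightarrow> continuous_on E (\<lambda>y. f t ((t - a) powr (\<gamma> - 1) * y))"
    and "\<And>y. y \<in> E \<Longrightarrow>
           (\<lambda>t. f t ((t - a) powr (\<gamma> - 1) * y)) \<in> borel_measurable (lebesgue_on {a<..a+h})"
    and "\<And>t y. t \<in> {a<..a+h} \<Longrightarrow> y \<in> E \<Longrightarrow>
           \<bar>f t ((t - a) powr (\<gamma> - 1) * y)\<bar> \<le> M * (t - a) powr k"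
    and "\<exists>A>0. \<forall>t\<in>{a<..a+l}. \<forall>y1\<in>E. \<forall>y2\<in>E.
           \<bar>f t ((t - a) powr (\<gamma> - 1) * y1) - f t ((t - a) powr (\<gamma> - 1) * y2)\<bar>
             \<le> A * (t - a) powr k * \<bar>y1 - y2\<bar>"
    and "\<phi> = picard_iter \<alpha> \<gamma> a x0 f"
  shows "(\<forall>n. \<forall>t\<in>{a<..a+l}. (t, \<phi> n t) \<in> dom_G \<gamma> a h x0 b
             \<and> set_integrable lebesgue {a<..<t} (frac_integrand \<alpha> f (\<phi> n) t))
       \<and> (\<forall>n. ((\<lambda>t. (t - a) powr (1 - \<gamma>) * \<phi> n t) \<longlongrightarrow> x0) (at_right a))
       \<and> uniformly_convergent_on {a..a+l}
           (\<lambda>n t. if t = a then x0 else (t - a) powr (1 - \<gamma>) * \<phi> n t)"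
proof -
  note [simp] = assms(1-4,7-8)
  \<comment> \<open>The exponent gained per iteration: the kernel turns
    \<open>(s - a) powr k\<close> into \<open>(t - a) powr (\<alpha> + k)\<close>, and the weight
    adds \<open>1 - \<gamma>\<close>.\<close>
  define \<delta> where "\<delta> = \<mu> + k"
  define B where "B = Beta \<alpha> (k + 1) / Gamma \<alpha>"
  define g where "g t y = f t ((t - a) powr (\<gamma> - 1) * y)" for t y
  define u where "u n t = (t - a) powr (1 - \<gamma>) * \<phi> n t" for n t
  define F where "F n s = f s (\<phi> n s)" for n s
  define J where "J n t = (LINT s:{a<..<t}|lebesgue. (t - s) powr (\<alpha> - 1) / Gamma \<alpha> * F n s)" for n t
  let ?T = "{a<..a + l}"
  obtain A where A: "A > 0" and Lip: "\<And>t y1 y2. t \<in> ?T \<Longrightarrow> y1 \<in> E \<Longrightarrow> y2 \<in> E \<Longrightarrow>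
      \<bar>g t y1 - g t y2\<bar> \<le> A * (t - a) powr k * \<bar>y1 - y2\<bar>"
    using assms(16) unfolding g_def by blast
  have E: "E = {x0 - b..x0 + b}" using assms(11) by (auto simp: range_E_def)
  have "0 \<le> \<beta> * (1 - \<alpha>)" using less_imp_le[OF assms(2)] assms(3) by (intro mult_nonneg_nonneg) auto
  then have k: "k + 1 > 0" using assms(9) by linarith
  have \<delta>: "\<delta> > 0" using assms(6,9) by (simp add: \<delta>_def)
  have exps: "1 - \<gamma> + \<alpha> = \<mu>" using assms(5,6) by simp
  have G: "Gamma \<alpha> > 0" by simp
  have Bpos: "Beta \<alpha> x > 0" if "x > 0" for x
    using that by (simp add: Beta_def add_pos_pos)
  have B: "B > 0" using Bpos[OF k] G by (simp add: B_def)
  have l_le: "l \<le> h" using assms(12) by (auto simp: existence_length_def)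
  have l: "l > 0"
    using assms(10,12) Bpos[OF k] less_imp_neq[OF G] less_imp_neq[OF assms(8)] by (auto simp: existence_length_def)
  \<comment> \<open>For nonzero \<open>M\<close>, the second argument of \<open>min\<close> in
    \<open>existence_length\<close> is the \<open>x\<close> solving
    \<open>M * B * x powr \<delta> = b\<close>.\<close>
  have l_bound: "M * B * (t - a) powr \<delta> \<le> b" if "t \<in> ?T" for t
  proof (cases "M = 0")
    case False
    then have M: "M > 0" using assms(10) by simp
    have "(t - a) powr \<delta> \<le> ((b / M * (Gamma \<alpha> / Beta \<alpha> (k + 1))) powr (1 / \<delta>)) powr \<delta>"
      using that \<delta> M assms(12) by (intro powr_mono2) (auto simp: existence_length_def \<delta>_def)
    also have "\<dots> = b / (M * B)"
      using \<delta> M Bpos[OF k] G mult_pos_pos[OF assms(8) G] by (simp add: powr_powr B_def abs_of_pos)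
    finally show ?thesis using M B by (simp add: field_simps)
  qed (simp add: less_imp_le)

  \<comment> \<open>The hypotheses speak about \<open>g\<close>, the iteration about
    \<open>f\<close>. At \<open>s = a\<close> both powers are 0 and do not cancel, hence the
    condition \<open>a < s\<close>.\<close>
  have F_g: "F n s = g s (u n s)" if "a < s" for n s
  proof -
    have "(s - a) powr (\<gamma> - 1) * (s - a) powr (1 - \<gamma>) = 1"
      using that by (simp flip: powr_add)
    then show ?thesis unfolding F_def g_def u_def by (simp flip: mult.assoc)
  qed
  have u_0: "u 0 t = x0" if "a < t" for t
  proof -
    have "(t - a) powr (1 - \<gamma>) * (t - a) powr (\<gamma> - 1) = 1"
      using that by (simp flip: powr_add)
    then show ?thesis by (simp add: u_def assms(17))
  qed
  have u_Suc: "u (Suc n) t = x0 + (t - a) powr (1 - \<gamma>) * J n t" if "a < t" for n t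
    using u_0[OF that]
    by (simp add: u_def assms(17) J_def F_def frac_integrand_def distrib_left)

  \<comment> \<open>Stated conditionally on a single \<open>n\<close> so as to be available inside
    the induction for \<open>bounds\<close>.\<close>
  have F_meas: "F n \<in> borel_measurable (lebesgue_on ?T)"
    and F_bound: "\<And>s. s \<in> ?T \<Longrightarrow> \<bar>F n s\<bar> \<le> M * (s - a) powr k"
    if u: "u n \<in> borel_measurable (lebesgue_on ?T)" and ran: "\<And>t. t \<in> ?T \<Longrightarrow> u n t \<in> E" for n
  proof -
    have "(\<lambda>s. g s (u n s)) \<in> borel_measurable (lebesgue_on ?T)"
    proof (rule borel_measurable_Caratheodory_compose[OF _ _ u])
      show "continuous_on {x0 - b..x0 + b} (g t)" if "t \<in> space (lebesgue_on ?T)" for t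
        using assms(13)[of t] that l_le unfolding E g_def by (simp add: space_restrict_space)
      show "(\<lambda>t. g t y) \<in> borel_measurable (lebesgue_on ?T)" if "y \<in> {x0 - b..x0 + b}" for y
        unfolding g_def by (rule measurable_restrict_mono[OF assms(14)]) (use that l_le E in auto)
    qed (use ran E in \<open>auto simp: space_restrict_space\<close>)
    then show "F n \<in> borel_measurable (lebesgue_on ?T)"
      by (subst measurable_cong[where g = "\<lambda>s. g s (u n s)"]) (auto simp: F_g space_restrict_space)
    show "\<bar>F n s\<bar> \<le> M * (s - a) powr k" if "s \<in> ?T" for s
      using assms(15)[of s "u n s"] ran[OF that] that l_le by (simp add: F_g g_def)
  qed

  \<comment> \<open>The two claims need each other: measurability of \<open>u n\<close> makes
    \<open>F n\<close> integrable against the kernel only once the bound, with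
    \<open>l_bound\<close>, places \<open>u n\<close> in \<open>E\<close>. The bound does not worsen
    with \<open>n\<close> because it comes from \<open>M\<close> alone.\<close>
  have bounds: "u n \<in> borel_measurable (lebesgue_on ?T)
      \<and> (\<forall>t\<in>?T. \<bar>u n t - x0\<bar> \<le> M * B * (t - a) powr \<delta>)" for n
  proof (induction n)
    case 0
    have "u 0 \<in> borel_measurable (lebesgue_on ?T)"
      by (subst measurable_cong[where g = "\<lambda>_. x0"]) (auto simp: u_0 space_restrict_space)
    then show ?case using assms(10) B by (simp add: u_0)
  next
    case (Suc n)
    have ran: "u n t \<in> E" if "t \<in> ?T" for t
      using Suc that l_bound[OF that] unfolding E by fastforce
    note Fm = F_meas[OF conjunct1[OF Suc] ran] and Fb = F_bound[OF conjunct1[OF Suc] ran]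
    have J: "J n \<in> borel_measurable (lebesgue_on ?T)"
      unfolding J_def by (rule borel_measurable_Volterra_integral[OF _ Fm]) measurable
    have "(\<lambda>t. (t - a) powr (1 - \<gamma>)) \<in> borel_measurable lborel"
      by measurable
    then have "(\<lambda>t. (t - a) powr (1 - \<gamma>)) \<in> borel_measurable (lebesgue_on ?T)"
      by (intro measurable_restrict_space1 measurable_completion)
    then have "(\<lambda>t. x0 + (t - a) powr (1 - \<gamma>) * J n t) \<in> borel_measurable (lebesgue_on ?T)"
      using J by (intro borel_measurable_add borel_measurable_times borel_measurable_const)
    then have "u (Suc n) \<in> borel_measurable (lebesgue_on ?T)"
      by (subst measurable_cong[where g = "\<lambda>t. x0 + (t - a) powr (1 - \<gamma>) * J n t"])
         (auto simp: u_Suc space_restrict_space)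
    moreover have "\<bar>u (Suc n) t - x0\<bar> \<le> M * B * (t - a) powr \<delta>" if t: "t \<in> ?T" for t
    proof -
      have "\<bar>J n t\<bar> \<le> M * (Beta \<alpha> (k + 1) / Gamma \<alpha>) * (t - a) powr (\<alpha> + (k + 1) - 1)"
        unfolding J_def
      proof (rule Abel_integral_bound(2))
        show "F n \<in> borel_measurable (lebesgue_on {a<..<t})"
          using Fm by (rule measurable_restrict_mono) (use t in auto)
      qed (use k t Fb in auto)
      then have "(t - a) powr (1 - \<gamma>) * \<bar>J n t\<bar> \<le> (t - a) powr (1 - \<gamma>) * (M * B * (t - a) powr (\<alpha> + k))"
        by (intro mult_left_mono) (auto simp: B_def)
      also have "\<dots> = M * B * (t - a) powr \<delta>"
        unfolding \<delta>_def exps[symmetric] by (simp add: powr_add)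
      finally show ?thesis using t by (simp add: u_Suc abs_mult)
    qed
    ultimately show ?case by blast
  qed
  have u_near: "\<bar>u n t - x0\<bar> \<le> M * B * (t - a) powr \<delta>" if "t \<in> ?T" for n t
    using bounds that by blast
  have u_ran: "u n t \<in> E" if "t \<in> ?T" for n t
    using u_near[OF that, of n] l_bound[OF that] unfolding E by auto
  have Fm: "F n \<in> borel_measurable (lebesgue_on {a<..<t})" if "t \<in> ?T" for n t
    using F_meas[OF conjunct1[OF bounds] u_ran] by (rule measurable_restrict_mono) (use that in auto)
  have Fb: "\<bar>F n s\<bar> \<le> M * (s - a) powr k" if "s \<in> ?T" for n s
    using F_bound[OF conjunct1[OF bounds] u_ran that] .
  have int: "set_integrable lebesgue {a<..<t} (\<lambda>s. (t - s) powr (\<alpha> - 1) / Gamma \<alpha> * F n s)"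
    if "t \<in> ?T" for n t
    by (rule Abel_integral_bound(1)[where q = "k + 1" and C = M, OF _ _ _ Fm[OF that]])
       (use k that Fb in auto)

  \<comment> \<open>Estimate of successive increments\<close>
  \<comment> \<open>The Lipschitz weight contributes the exponent \<open>k\<close> and the previous
    increment \<open>\<delta> * real (Suc i)\<close>; their sum is \<open>q - 1\<close> in
    \<open>Abel_integral_bound\<close>.\<close>
  define r where "r i = A * (Beta \<alpha> (k + 1 + \<delta> * real (Suc i)) / Gamma \<alpha>)" for i
  define c where "c n = M * B * (\<Prod>i<n. r i)" for n
  have incr: "\<bar>u (Suc n) t - u n t\<bar> \<le> c n * (t - a) powr (\<delta> * real (Suc n))" if "t \<in> ?T" for n t
    using that
  proof (induction n arbitrary: t)
    \<comment> \<open>As \<open>u 0\<close> equals \<open>x0\<close> to the right of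
      \<open>a\<close>, the first increment is bounded by \<open>u_near\<close>; the empty product
      gives \<open>c 0 = M * B\<close>.\<close>
    case 0
    then show ?case using u_near[of t 1] by (simp add: u_0 c_def)
  next
    case (Suc n)
    let ?q = "k + 1 + \<delta> * real (Suc n)"
    have q: "?q > 0" using \<delta> by (intro add_pos_nonneg[OF k]) simp
    have "J (Suc n) t - J n t = (LINT s:{a<..<t}|lebesgue.
        (t - s) powr (\<alpha> - 1) / Gamma \<alpha> * F (Suc n) s - (t - s) powr (\<alpha> - 1) / Gamma \<alpha> * F n s)"
      unfolding J_def by (rule set_integral_diff(2)[symmetric]) (rule int[OF Suc.prems])+
    also have "\<dots> = (LINT s:{a<..<t}|lebesgue. (t - s) powr (\<alpha> - 1) / Gamma \<alpha> * (F (Suc n) s - F n s))"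
      by (simp only: right_diff_distrib)
    also have "\<bar>\<dots>\<bar> \<le> A * c n * (Beta \<alpha> ?q / Gamma \<alpha>) * (t - a) powr (\<alpha> + ?q - 1)"
    proof (rule Abel_integral_bound(2))
      show "(\<lambda>s. F (Suc n) s - F n s) \<in> borel_measurable (lebesgue_on {a<..<t})"
        using Fm[OF Suc.prems] by (intro borel_measurable_diff)
      show "\<bar>F (Suc n) s - F n s\<bar> \<le> A * c n * (s - a) powr (?q - 1)" if "a < s" "s < t" for s
      proof -
        have s: "s \<in> ?T" using that Suc.prems by auto
        have "\<bar>F (Suc n) s - F n s\<bar> \<le> A * (s - a) powr k * \<bar>u (Suc n) s - u n s\<bar>"
          using Lip[OF s u_ran[OF s] u_ran[OF s]] that by (simp add: F_g)
        also have "\<dots> \<le> A * (s - a) powr k * (c n * (s - a) powr (\<delta> * real (Suc n)))"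
          using Suc.IH[OF s] A by (intro mult_left_mono) auto
        also have "\<dots> = A * c n * (s - a) powr (?q - 1)"
          by (simp add: powr_add)
        finally show ?thesis .
      qed
    qed (use q Suc.prems in auto)
    also have "A * c n * (Beta \<alpha> ?q / Gamma \<alpha>) = c (Suc n)"
      by (simp add: c_def r_def)
    finally have "(t - a) powr (1 - \<gamma>) * \<bar>J (Suc n) t - J n t\<bar>
        \<le> (t - a) powr (1 - \<gamma>) * (c (Suc n) * (t - a) powr (\<alpha> + ?q - 1))"
      by (intro mult_left_mono) auto
    also have "\<dots> = c (Suc n) * (t - a) powr (1 - \<gamma> + (\<alpha> + ?q - 1))"
      by (simp add: powr_add)
    \<comment> \<open>Here \<open>1 - \<gamma> + \<alpha> + k\<close> is \<open>\<delta>\<close>, so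
      the exponent advances by exactly one \<open>\<delta>\<close>.\<close>
    also have "1 - \<gamma> + (\<alpha> + ?q - 1) = \<delta> * real (Suc (Suc n))"
      using exps by (simp add: \<delta>_def algebra_simps)
    also have "(t - a) powr (1 - \<gamma>) * \<bar>J (Suc n) t - J n t\<bar> = \<bar>u (Suc (Suc n)) t - u (Suc n) t\<bar>"
      using Suc.prems by (simp add: u_Suc abs_mult flip: right_diff_distrib)
    finally show ?case .
  qed

  \<comment> \<open>Summability of the majorants\<close>
  have r_pos: "r i \<ge> 0" for i
  proof -
    have "k + 1 + \<delta> * real (Suc i) > 0" using \<delta> by (intro add_pos_nonneg[OF k]) simp
    from Bpos[OF this] show ?thesis using A G unfolding r_def by (simp add: less_imp_le)
  qed
  have c_pos: "c n \<ge> 0" for n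
    using assms(10) B r_pos by (simp add: c_def prod_nonneg)
  have summ: "summable (\<lambda>n. c n * l powr (\<delta> * real (Suc n)))"
  proof -
    have "filterlim (\<lambda>n. k + 1 + \<delta> * real (Suc n)) at_top sequentially"
      using \<delta> by (intro filterlim_tendsto_add_at_top[OF tendsto_const]
          filterlim_tendsto_pos_mult_at_top[OF tendsto_const]
          filterlim_compose[OF filterlim_real_sequentially filterlim_Suc]) auto
    from filterlim_compose[OF Beta_tendsto_0[of \<alpha>] this]
    have "(\<lambda>n. A * (Beta \<alpha> (k + 1 + \<delta> * real (Suc n)) / Gamma \<alpha>) * l powr \<delta>) \<longlonglongrightarrow> A * (0 / Gamma \<alpha>) * l powr \<delta>"
      using less_imp_neq[OF G] by (intro tendsto_intros) auto
    then have "(\<lambda>n. r n * l powr \<delta>) \<longlonglongrightarrow> 0" by (simp add: r_def)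
    then have "\<forall>\<^sub>F n in sequentially. r n * l powr \<delta> < 1/2"
      by (rule order_tendstoD) simp
    then obtain N where N: "\<And>n. n \<ge> N \<Longrightarrow> r n * l powr \<delta> < 1/2"
      by (auto simp: eventually_sequentially)
    show ?thesis
    proof (rule summable_ratio_test[where c = "1/2" and N = N])
      fix n assume "n \<ge> N"
      have pow: "l powr (\<delta> * real (Suc (Suc n))) = l powr \<delta> * l powr (\<delta> * real (Suc n))"
        by (simp add: algebra_simps flip: powr_add)
      have "c (Suc n) * l powr (\<delta> * real (Suc (Suc n)))
          = (r n * l powr \<delta>) * (c n * l powr (\<delta> * real (Suc n)))"
        by (simp add: c_def pow del: of_nat_Suc)
      also have "\<dots> \<le> 1/2 * (c n * l powr (\<delta> * real (Suc n)))"
        using N[OF \<open>n \<ge> N\<close>] c_pos by (intro mult_right_mono) auto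
      finally show "norm (c (Suc n) * l powr (\<delta> * real (Suc (Suc n))))
          \<le> 1/2 * norm (c n * l powr (\<delta> * real (Suc n)))"
        using c_pos by (simp add: abs_mult)
    qed simp
  qed

  \<comment> \<open>Uniform limit and behaviour at the left endpoint\<close>
  \<comment> \<open>Since \<open>0 powr x = 0\<close>, the formula for \<open>u n\<close> gives 0 at
    \<open>a\<close>; the limit \<open>x0\<close> has to be inserted explicitly.\<close>
  define v where "v n t = (if t = a then x0 else u n t)" for n t
  have "uniformly_convergent_on {a..a+l} (\<lambda>n t. \<Sum>i<n. v (Suc i) t - v i t)"
  proof (rule Weierstrass_m_test'[OF _ summ])
    fix n t assume t: "t \<in> {a..a+l}"
    show "norm (v (Suc n) t - v n t) \<le> c n * l powr (\<delta> * real (Suc n))"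
    proof (cases "t = a")
      case True
      then show ?thesis using c_pos by (simp add: v_def)
    next
      case False
      then have "\<bar>v (Suc n) t - v n t\<bar> \<le> c n * (t - a) powr (\<delta> * real (Suc n))"
        using incr[of t n] t by (simp add: v_def)
      also have "\<dots> \<le> c n * l powr (\<delta> * real (Suc n))"
        using c_pos \<delta> t by (intro mult_left_mono powr_mono2) auto
      finally show ?thesis by simp
    qed
  qed
  moreover have v_0: "v 0 t = x0" if "a \<le> t" for t
    using that by (simp add: v_def u_0)
  ultimately have "uniformly_convergent_on {a..a+l} (\<lambda>n t. x0 + (\<Sum>i<n. v (Suc i) t - v i t))"
    by (intro uniformly_convergent_add uniformly_convergent_on_const)
  \<comment> \<open>Adding \<open>x0\<close>, which is \<open>v 0 t\<close>, turns the telescoping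
    sum into \<open>v n t\<close>.\<close>
  also have "?this \<longleftrightarrow> uniformly_convergent_on {a..a+l} v"
    by (intro uniformly_convergent_cong always_eventually allI ballI)
       (simp_all add: sum_lessThan_telescope[where f = "\<lambda>n. v n t" for t] v_0)
  finally have conv: "uniformly_convergent_on {a..a+l} v" .

  have lim: "(u n \<longlongrightarrow> x0) (at_right a)" for n
  proof -
    have "((\<lambda>t. (t - a) powr \<delta>) \<longlongrightarrow> 0) (at_right a)"
    proof (rule tendsto_eq_rhs)
      \<comment> \<open>The base tends to 0, so continuity of the power rests on
        \<open>\<delta> > 0\<close> and a base that is eventually nonnegative.\<close>
      show "((\<lambda>t. (t - a) powr \<delta>) \<longlongrightarrow> (a - a) powr \<delta>) (at_right a)"
        using \<delta> by (intro tendsto_powr' tendsto_intros)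
           (auto intro!: eventually_at_rightI[of a "a + 1"])
    qed simp
    from tendsto_mult_right_zero[OF this, of "M * B"]
    have "((\<lambda>t. u n t - x0) \<longlongrightarrow> 0) (at_right a)"
    proof (rule Lim_null_comparison[rotated])
      show "\<forall>\<^sub>F t in at_right a. norm (u n t - x0) \<le> M * B * (t - a) powr \<delta>"
        using eventually_at_right_real[of a "a + l"] l
        by (auto elim!: eventually_mono intro!: u_near)
    qed
    then show ?thesis by (simp add: LIM_zero_iff)
  qed

  \<comment> \<open>This certifies that the iterates stay where \<open>f\<close> is given and that
    no integral takes the default value 0 of a non-integrable function.\<close>
  have "(t, \<phi> n t) \<in> dom_G \<gamma> a h x0 b
      \<and> set_integrable lebesgue {a<..<t} (frac_integrand \<alpha> f (\<phi> n) t)" if "t \<in> ?T" for n t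
    using u_ran[OF that, of n] int[OF that, of n] that l_le
    by (auto simp: dom_G_def u_def assms(11) frac_integrand_def[abs_def] F_def)
  then show ?thesis
    using lim conv unfolding v_def[abs_def] u_def[abs_def] by blast
qed

end
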